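(* Let $e\ge 3$, $I=\{0,\dots,e-1\}=\mathbb Z/e\mathbb Z$, $k\in I$, $\ell\ge1$, $\boldsymbol\kappa\in I^\ell$, and let $\boldsymbol\lambda$ be an $\ell$-partition (with residues with respect to $\boldsymbol\kappa$ modulo $e$) which is $k$-horizontal. Then for every standard $\boldsymbol\lambda$-tableau $T$ one has $\deg T=\deg \Phi_k(T)$, where $\Phi_k(T)$ is the subdivided standard tableau of shape $\Phi_k(\boldsymbol\lambda)$, whose degree is computed with respect to $e+1$ and the charge $\overline{\boldsymbol\kappa}$.
   Context: Nodes of an $\ell$-partition $\boldsymbol\lambda=(\boldsymbol\lambda^{(1)},\dots,\boldsymbol\lambda^{(\ell)})$ are triples $(m,r,c)$ (component, row, column), with residue $\kappa_m+c-r \bmod e$. A node of residue $i$ is an $i$-node. $\boldsymbol\lambda$ is *$k$-horizontal* if in no component $m$ there is $r$ with $(m,r,1),(m,r+1,1)\in[\boldsymbol\lambda]$ and $\operatorname{res}(m,r,1)\equiv k+1\pmod e$. *Subdivision of a $k$-horizontal $\boldsymbol\lambda$.* $\boldsymbol\mu=\Phi_k(\boldsymbol\lambda)$ is the $\ell$-partition obtained by inserting a new node immediately to the right of every $k$-node of $[\boldsymbol\lambda]$; i.e. $\boldsymbol\mu^{(m)}_r=\boldsymbol\lambda^{(m)}_r+\#\{k\text{-nodes in row } r \text{ of component } m\}$. Residues on $\boldsymbol\mu$ are taken modulo $e+1$ with respect to the charge $\overline{\boldsymbol\kappa}$, $\overline\kappa_m=\kappa_m$ if $0\le\kappa_m\le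 k$ and $\overline\kappa_m=\kappa_m+1$ if $k<\kappa_m\le e-1$. For $A=(m,r,c)\in[\boldsymbol\lambda]$ let $A^+=(m,r,c+p)\in[\boldsymbol\mu]$, where $p$ is the number of $k$-nodes $(m,r,x)$ with $x<c$; if $A$ is a $k$-node let $A^\sharp$ be the node immediately to the right of $A^+$. Every node of $[\boldsymbol\mu]$ is exactly one of these. *Subdivision of tableaux.* A $\boldsymbol\lambda$-tableau is a bijection $T:[\boldsymbol\lambda]\to\{1,\dots,n\}$; it is standard if entries increase along rows and down columns in each component. Let $\phi^T(t)=t+\#\{1\le j<t\mid \operatorname{res}(T^{-1}(j))=k\}$. Then $\Phi_k(T)$ is the $\boldsymbol\mu$-tableau with $\Phi_k(T)(A^+)=\phi^T(T(A))$ for all $A\in[\boldsymbol\lambda]$ and $\Phi_k(T)(A^\sharp)=\phi^T(T(A))+1$ for all $k$-nodes $A$; it is standard when $T$ is. *Degree.* A node $A\in[\boldsymbol\lambda]$ is removable if $[\boldsymbol\lambda]\setminus\{A\}$ is the diagram of an $\ell$-partition; $B\notin[\boldsymbol\lambda]$ is addable if $[\boldsymbol\lambda]\cup\{B\}$ is. $(m',r',c')$ is below $(m,r,c)$ if $m'>m$, or $m'=m$ and $r'>r$. For a removable $i$-node $A$, $d_A(\boldsymbol\lambda)=\#\{\text{addable } i\text{-nodes of }\boldsymbol\lambda\text{ below }A\}-\#\{\text{removable } i\text{-nodes of }\boldsymbol\lambda\text{ below }A\}$. For $T$ standard of shape $\boldsymbol\lambda$ with $n$ nodes, $\deg(\varnothing)=0$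 and $\deg T=d_A(\boldsymbol\lambda)+\deg(T{\downarrow}(n-1))$, where $A=T^{-1}(n)$ and $T{\downarrow}(n-1)$ is $T$ with the entry $n$ removed. For $\boldsymbol\mu$ the same definition is used with $e+1$ and $\overline{\boldsymbol\kappa}$. *)

theory Defs
  imports Main "HOL-Number_Theory.Cong"
begin

text \<open>
  Components, rows and columns are numbered from 1. An \<open>\<ell>\<close>-partition is a function giving the
  length \<open>la m r\<close> of row \<open>r\<close> of component \<open>m\<close>; its values outside \<open>1 \<le> m \<le> \<ell>\<close> and \<open>r \<ge> 1\<close>
  are irrelevant. Likewise a charge is only used on \<open>{1..\<ell>}\<close>. Elements of
  the integers mod \<open>e\<close> are represented by integers in \<open>{0..<e}\<close>.
\<close>

type_synonym node = "nat \<times> nat \<times> nat"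
type_synonym charge = "nat \<Rightarrow> int"
type_synonym shape = "nat \<Rightarrow> nat \<Rightarrow> nat"

definition multipartition :: "nat \<Rightarrow> shape \<Rightarrow> bool" where
  "multipartition l la \<longleftrightarrow>
     (\<forall>m\<in>{1..l}. (\<forall>r\<ge>1. la m (Suc r) \<le> la m r) \<and> finite {r. 1 \<le> r \<and> la m r \<noteq> 0})"

definition diagram :: "nat \<Rightarrow> shape \<Rightarrow> node set" where
  "diagram l la = {(m, r, c). 1 \<le> m \<and> m \<le> l \<and> 1 \<le> r \<and> 1 \<le> c \<and> c \<le> la m r}"

definition is_diagram :: "nat \<Rightarrow> node set \<Rightarrow> bool" where
  "is_diagram l D \<longleftrightarrow> (\<exists>la. multipartition l la \<and> D = diagram l la)"

fun res :: "int \<Rightarrow> charge \<Rightarrow> node \<Rightarrow> int" where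
  "res e kap (m, r, c) = (kap m + int c - int r) mod e"

definition horizontal :: "int \<Rightarrow> charge \<Rightarrow> nat \<Rightarrow> int \<Rightarrow> shape \<Rightarrow> bool" where
  "horizontal e kap l k la \<longleftrightarrow>
     \<not> (\<exists>m r. (m, r, 1) \<in> diagram l la \<and> (m, r + 1, 1) \<in> diagram l la \<and>
              [res e kap (m, r, 1) = k + 1] (mod e))"


subsection \<open>Tableaux and degrees\<close>

text \<open>
  A tableau is a total function on nodes of which only the values on the diagram \<open>D\<close> matter.
  In particular restricting a tableau amounts to shrinking \<open>D\<close>.
\<close>

definition tableau :: "node set \<Rightarrow> (node \<Rightarrow> nat) \<Rightarrow> bool" where
  "tableau D T \<longleftrightarrow> bij_betw T D {1..card D}"

definition standard_tableau :: "node set \<Rightarrow> (node \<Rightarrow> nat) \<Rightarrow> bool" where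
  "standard_tableau D T \<longleftrightarrow> tableau D T \<and>
     (\<forall>m r c c'. (m, r, c) \<in> D \<and> (m, r, c') \<in> D \<and> c < c' \<longrightarrow> T (m, r, c) < T (m, r, c')) \<and>
     (\<forall>m r r' c. (m, r, c) \<in> D \<and> (m, r', c) \<in> D \<and> r < r' \<longrightarrow> T (m, r, c) < T (m, r', c))"

definition removable :: "nat \<Rightarrow> node set \<Rightarrow> node \<Rightarrow> bool" where
  "removable l D A \<longleftrightarrow> A \<in> D \<and> is_diagram l (D - {A})"

definition addable :: "nat \<Rightarrow> node set \<Rightarrow> node \<Rightarrow> bool" where
  "addable l D B \<longleftrightarrow> B \<notin> D \<and> is_diagram l (D \<union> {B})"

fun below :: "node \<Rightarrow> node \<Rightarrow> bool" where
  "below (m', r', c') (m, r, c) \<longleftrightarrow> m' > m \<or> m' = m \<and> r' > r"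

definition node_degree :: "int \<Rightarrow> charge \<Rightarrow> nat \<Rightarrow> node set \<Rightarrow> node \<Rightarrow> int" where
  "node_degree e kap l D A =
     int (card {B. addable l D B \<and> res e kap B = res e kap A \<and> below B A}) -
     int (card {B. removable l D B \<and> res e kap B = res e kap A \<and> below B A})"

primrec degree_rec :: "int \<Rightarrow> charge \<Rightarrow> nat \<Rightarrow> (node \<Rightarrow> nat) \<Rightarrow> nat \<Rightarrow> node set \<Rightarrow> int" where
  "degree_rec e kap l T 0 D = 0"
| "degree_rec e kap l T (Suc n) D =
     (let A = inv_into D T (Suc n)
      in node_degree e kap l D A + degree_rec e kap l T n (D - {A}))"

definition degree :: "int \<Rightarrow> charge \<Rightarrow> nat \<Rightarrow> node set \<Rightarrow> (node \<Rightarrow> nat) \<Rightarrow> int" where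
  "degree e kap l D T = degree_rec e kap l T (card D) D"


subsection \<open>Subdivision\<close>

definition subdiv_shape :: "int \<Rightarrow> charge \<Rightarrow> nat \<Rightarrow> int \<Rightarrow> shape \<Rightarrow> shape" where
  "subdiv_shape e kap l k la m r =
     la m r + card {c. (m, r, c) \<in> diagram l la \<and> res e kap (m, r, c) = k}"

definition subdiv_charge :: "int \<Rightarrow> charge \<Rightarrow> charge" where
  "subdiv_charge k kap m = (if kap m \<le> k then kap m else kap m + 1)"

fun plus_node :: "int \<Rightarrow> charge \<Rightarrow> int \<Rightarrow> node set \<Rightarrow> node \<Rightarrow> node" where
  "plus_node e kap k D (m, r, c) =
     (m, r, c + card {x. x < c \<and> (m, r, x) \<in> D \<and> res e kap (m, r, x) = k})"

fun right_node :: "node \<Rightarrow> node" where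
  "right_node (m, r, c) = (m, r, c + 1)"

definition sharp_node :: "int \<Rightarrow> charge \<Rightarrow> int \<Rightarrow> node set \<Rightarrow> node \<Rightarrow> node" where
  "sharp_node e kap k D A = right_node (plus_node e kap k D A)"

definition subdiv_entry ::
    "int \<Rightarrow> charge \<Rightarrow> int \<Rightarrow> node set \<Rightarrow> (node \<Rightarrow> nat) \<Rightarrow> nat \<Rightarrow> nat" where
  "subdiv_entry e kap k D T t =
     t + card {j. 1 \<le> j \<and> j < t \<and> res e kap (inv_into D T j) = k}"

text \<open>
  Nodes of the subdivided diagram that are not of the form \<open>A\<^sup>+\<close> are of the form \<open>A\<^sup>\<sharp>\<close> for a unique
  \<open>k\<close>-node \<open>A\<close>. The lemmas \<open>subdiv_tableau_plus\<close> and \<open>subdiv_tableau_sharp\<close> below are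
  the two equations characterizing the subdivided tableau.
\<close>

definition subdiv_tableau ::
    "int \<Rightarrow> charge \<Rightarrow> int \<Rightarrow> node set \<Rightarrow> (node \<Rightarrow> nat) \<Rightarrow> node \<Rightarrow> nat" where
  "subdiv_tableau e kap k D T B =
     (if B \<in> plus_node e kap k D ` D
      then subdiv_entry e kap k D T (T (inv_into D (plus_node e kap k D) B))
      else subdiv_entry e kap k D T
             (T (inv_into {A \<in> D. res e kap A = k} (sharp_node e kap k D) B)) + 1)"

lemma plus_node_less:
  assumes "c < c'"
  shows "c + card {x. x < c \<and> (m, r, x) \<in> D \<and> res e kap (m, r, x) = k}
       < c' + card {x. x < c' \<and> (m, r, x) \<in> D \<and> res e kap (m, r, x) = k}"
proof -
  have "card {x. x < c \<and> (m, r, x) \<in> D \<and> res e kap (m, r, x) = k}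
      \<le> card {x. x < c' \<and> (m, r, x) \<in> D \<and> res e kap (m, r, x) = k}"
    using assms by (intro card_mono) auto
  then show ?thesis using assms by linarith
qed

lemma inj_plus_node: "inj_on (plus_node e kap k D) S"
proof (rule inj_onI)
  fix A B assume eq: "plus_node e kap k D A = plus_node e kap k D B"
  obtain m r c where A: "A = (m, r, c)" by (cases A)
  obtain m' r' c' where B: "B = (m', r', c')" by (cases B)
  show "A = B"
    using eq plus_node_less[of c c' m r D e kap k] plus_node_less[of c' c m r D e kap k]
    by (cases c c' rule: linorder_cases) (auto simp: A B)
qed

lemma sharp_node_not_plus:
  assumes A: "A \<in> D" "res e kap A = k"
  shows "sharp_node e kap k D A \<notin> plus_node e kap k D ` D"
proof
  assume "sharp_node e kap k D A \<in> plus_node e kap k D ` D"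
  then obtain B where eq: "sharp_node e kap k D A = plus_node e kap k D B" by blast
  obtain m r c where Ac: "A = (m, r, c)" by (cases A)
  obtain m' r' c' where B: "B = (m', r', c')" by (cases B)
  let ?S = "\<lambda>c. {x. x < c \<and> (m, r, x) \<in> D \<and> res e kap (m, r, x) = k}"
  from eq have [simp]: "m' = m" "r' = r" and cc: "c + card (?S c) + 1 = c' + card (?S c')"
    by (auto simp: Ac B sharp_node_def)
  have lt: "c < c'"
    using cc plus_node_less[of c' c m r D e kap k] by (cases c c' rule: linorder_cases) auto
  have "card (insert c (?S c)) \<le> card (?S c')"
    using lt A by (intro card_mono) (auto simp: Ac)
  moreover have "card (insert c (?S c)) = Suc (card (?S c))"
    by (subst card_insert_disjoint) auto
  ultimately show False using cc lt by linarith
qed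

lemma subdiv_tableau_plus:
  assumes "A \<in> D"
  shows "subdiv_tableau e kap k D T (plus_node e kap k D A) = subdiv_entry e kap k D T (T A)"
  using assms by (simp add: subdiv_tableau_def inv_into_f_f[OF inj_plus_node])

lemma subdiv_tableau_sharp:
  assumes "A \<in> D" "res e kap A = k"
  shows "subdiv_tableau e kap k D T (sharp_node e kap k D A) = subdiv_entry e kap k D T (T A) + 1"
proof -
  have "inj right_node" by (auto simp: inj_def)
  then have "inj_on (sharp_node e kap k D) {A \<in> D. res e kap A = k}"
    using inj_plus_node[of e kap k D] unfolding sharp_node_def inj_on_def by blast
  then show ?thesis
    using assms by (simp add: subdiv_tableau_def sharp_node_not_plus inv_into_f_f)
qed

end

theory Submission
  imports Defs
begin

text \<open>
  Horizontality says that no nonempty row but the first starts with a \<open>k\<close>-node. Hence, in nonempty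
  rows, subdivision relabels residues by the map that skips \<open>k + 1\<close>, and the new nodes have residue
  \<open>k + 1\<close>. Let \<open>A\<close> be the node with the largest entry. If \<open>A\<close> is not a \<open>k\<close>-node, then
  the addable and removable nodes with the residue of \<open>A\<close> correspond row by row before and after
  subdivision. If \<open>A\<close> is a \<open>k\<close>-node, its removal is subdivided into the removal of
  \<open>A\<^sup>\<sharp>\<close> and then of \<open>A\<^sup>+\<close>, and the two contributions add up to that of \<open>A\<close>:
  when two rows of equal length end in nodes of residues \<open>k\<close> and \<open>k - 1\<close>, subdivision creates a
  new removable \<open>(k + 1)\<close>-node in the first and a new addable \<open>k\<close>-node in the second, which cancel.
\<close>

declare res.simps [simp del]

section \<open>Addable and removable nodes by rows\<close>

text \<open>Removal of a node is expressed on row lengths, so that the smaller diagram again comes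
  with an explicit shape.\<close>

definition dec_row :: "shape \<Rightarrow> nat \<Rightarrow> nat \<Rightarrow> shape" where
  "dec_row la m r = la(m := (la m)(r := la m r - 1))"

text \<open>An addable or removable node is determined by its row, so counting nodes becomes
  counting rows. The case \<open>r = 1\<close> is separate because \<open>la m 0\<close> carries no
  meaning.\<close>

definition addable_rows :: "nat \<Rightarrow> shape \<Rightarrow> (nat \<times> nat) set" where
  "addable_rows l la = {(m, r). 1 \<le> m \<and> m \<le> l \<and> 1 \<le> r \<and> (r = 1 \<or> la m r < la m (r - 1))}"

definition removable_rows :: "nat \<Rightarrow> shape \<Rightarrow> (nat \<times> nat) set" where
  "removable_rows l la = {(m, r). 1 \<le> m \<and> m \<le> l \<and> 1 \<le> r \<and> la m (Suc r) < la m r}"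

section \<open>Shapes, row updates and finiteness\<close>

lemma multipartition_Suc_le:
  "multipartition l la \<Longrightarrow> 1 \<le> m \<Longrightarrow> m \<le> l \<Longrightarrow> 1 \<le> r \<Longrightarrow> la m (Suc r) \<le> la m r"
  by (auto simp: multipartition_def)

lemma multipartition_antimono:
  assumes "multipartition l la" "1 \<le> m" "m \<le> l" "1 \<le> r" "r \<le> r'"
  shows "la m r' \<le> la m r"
  using assms(5)
proof (induction r' rule: dec_induct)
  case (step n)
  then show ?case using multipartition_Suc_le[OF assms(1-3), of n] assms(4) by linarith
qed simp

lemma multipartition_pred_le:
  "multipartition l la \<Longrightarrow> 1 \<le> m \<Longrightarrow> m \<le> l \<Longrightarrow> 1 < r \<Longrightarrow> la m r \<le> la m (r - 1)"
  by (rule multipartition_antimono) auto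

lemma multipartition_finite_support:
  "multipartition l la \<Longrightarrow> 1 \<le> m \<Longrightarrow> m \<le> l \<Longrightarrow> finite {r. 1 \<le> r \<and> la m r \<noteq> 0}"
  by (auto simp: multipartition_def)

lemma multipartition_upd:
  assumes la: "multipartition l la"
    and up: "1 < r \<Longrightarrow> c \<le> la m (r - 1)" and low: "la m (Suc r) \<le> c"
  shows "multipartition l (la(m := (la m)(r := c)))"
  unfolding multipartition_def
proof (intro ballI conjI allI impI)
  fix m' assume m': "m' \<in> {1..l}"
  let ?la = "la(m := (la m)(r := c))"
  show "?la m' (Suc r') \<le> ?la m' r'" if "r' \<ge> 1" for r'
    using multipartition_Suc_le[OF la, of m' r'] m' that up low by auto
  have "finite (insert r {r. 1 \<le> r \<and> la m' r \<noteq> 0})"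
    using multipartition_finite_support[OF la] m' by auto
  then show "finite {r. 1 \<le> r \<and> ?la m' r \<noteq> 0}"
    by (rule rev_finite_subset) (auto split: if_splits)
qed

lemma multipartition_dec_row:
  assumes la: "multipartition l la" and r: "(m, r) \<in> removable_rows l la"
  shows "multipartition l (dec_row la m r)"
  unfolding dec_row_def
proof (rule multipartition_upd[OF la])
  show "la m r - 1 \<le> la m (r - 1)" if "1 < r"
    using multipartition_pred_le[OF la _ _ that, of m] r by (auto simp: removable_rows_def)
  show "la m (Suc r) \<le> la m r - 1" using r by (auto simp: removable_rows_def)
qed

lemma diagram_dec_row:
  assumes "(m, r) \<in> removable_rows l la"
  shows "diagram l (dec_row la m r) = diagram l la - {(m, r, la m r)}"
  using assms by (auto simp: diagram_def dec_row_def removable_rows_def split: if_splits)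

lemma finite_nonempty_rows:
  assumes "multipartition l la"
  shows "finite {(m, r). 1 \<le> m \<and> m \<le> l \<and> 1 \<le> r \<and> la m r \<noteq> 0}"
proof -
  have "{(m, r). 1 \<le> m \<and> m \<le> l \<and> 1 \<le> r \<and> la m r \<noteq> 0}
      = Sigma {1..l} (\<lambda>m. {r. 1 \<le> r \<and> la m r \<noteq> 0})" by auto
  then show ?thesis using multipartition_finite_support[OF assms] by auto
qed

lemma finite_diagram:
  assumes "multipartition l la"
  shows "finite (diagram l la)"
proof -
  have "diagram l la \<subseteq>
      (\<lambda>((m, r), c). (m, r, c)) `
        Sigma {(m, r). 1 \<le> m \<and> m \<le> l \<and> 1 \<le> r \<and> la m r \<noteq> 0} (\<lambda>(m, r). {1..la m r})"
    by (auto simp: diagram_def image_iff)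
  then show ?thesis
    by (rule finite_subset) (use finite_nonempty_rows[OF assms] in auto)
qed

lemma finite_removable_rows:
  "multipartition l la \<Longrightarrow> finite (removable_rows l la)"
  by (rule finite_subset[OF _ finite_nonempty_rows]) (auto simp: removable_rows_def)

lemma finite_addable_rows:
  assumes "multipartition l la"
  shows "finite (addable_rows l la)"
proof -
  have "addable_rows l la \<subseteq> {1..l} \<times> {1} \<union>
      (\<lambda>(m, r). (m, Suc r)) ` {(m, r). 1 \<le> m \<and> m \<le> l \<and> 1 \<le> r \<and> la m r \<noteq> 0}"
    (is "_ \<subseteq> ?A \<union> ?g ` ?R")
  proof (rule subrelI)
    fix m r assume a: "(m, r) \<in> addable_rows l la"
    have "(m, r) \<in> ?g ` ?R" if "r \<noteq> 1"
      using a that by (intro image_eqI[of _ _ "(m, r - 1)"]) (auto simp: addable_rows_def)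
    then show "(m, r) \<in> ?A \<union> ?g ` ?R"
      using a by (cases "r = 1") (auto simp: addable_rows_def)
  qed
  then show ?thesis by (rule finite_subset) (use finite_nonempty_rows[OF assms] in auto)
qed

lemma in_diagram_iff:
  "1 \<le> m \<Longrightarrow> m \<le> l \<Longrightarrow> 1 \<le> r \<Longrightarrow> 1 \<le> c \<Longrightarrow> (m, r, c) \<in> diagram l la \<longleftrightarrow> c \<le> la m r"
  by (auto simp: diagram_def)

text \<open>Each row of the remaining diagram is an initial segment, so only the last node of a row
  can go. If the row below also reached column \<open>c\<close>, it would become longer than the
  shortened row.\<close>

lemma removable_iff:
  assumes la: "multipartition l la"
  shows "removable l (diagram l la) (m, r, c) \<longleftrightarrow> (m, r) \<in> removable_rows l la \<and> c = la m r"
proof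
  assume "removable l (diagram l la) (m, r, c)"
  then obtain la' where D: "(m, r, c) \<in> diagram l la" and la': "multipartition l la'"
    and eq: "diagram l la - {(m, r, c)} = diagram l la'"
    by (auto simp: removable_def is_diagram_def)
  have m: "1 \<le> m" "m \<le> l" "1 \<le> r" "1 \<le> c" "c \<le> la m r" using D by (auto simp: diagram_def)
  have iff: "c' \<le> la' m r' \<longleftrightarrow> c' \<le> la m r' \<and> (r', c') \<noteq> (r, c)" if "1 \<le> r'" "1 \<le> c'" for r' c'
    using m that in_diagram_iff[of m l r' c'] eq by (metis Diff_iff Pair_inject singleton_iff)
  have c: "c = la m r" using iff[of r c] iff[of r "la m r"] m by simp
  have "\<not> c \<le> la m (Suc r)"
    using iff[of "Suc r" c] iff[of r c] m multipartition_Suc_le[OF la' m(1-3)] by simp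
  then show "(m, r) \<in> removable_rows l la \<and> c = la m r"
    using m c by (simp add: removable_rows_def)
next
  assume a: "(m, r) \<in> removable_rows l la \<and> c = la m r"
  then have "(m, r, c) \<in> diagram l la" by (auto simp: removable_rows_def diagram_def)
  moreover have "is_diagram l (diagram l la - {(m, r, c)})"
    unfolding is_diagram_def
    using a multipartition_dec_row[OF la, of m r] diagram_dec_row[of m r l la] by metis
  ultimately show "removable l (diagram l la) (m, r, c)"
    by (simp add: removable_def)
qed

lemma addable_iff:
  assumes la: "multipartition l la"
  shows "addable l (diagram l la) (m, r, c) \<longleftrightarrow> (m, r) \<in> addable_rows l la \<and> c = la m r + 1"
proof
  assume "addable l (diagram l la) (m, r, c)"
  then obtain la' where D: "(m, r, c) \<notin> diagram l la" and la': "multipartition l la'"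
    and eq: "diagram l la \<union> {(m, r, c)} = diagram l la'"
    by (auto simp: addable_def is_diagram_def)
  have "(m, r, c) \<in> diagram l la'" using eq by auto
  then have m: "1 \<le> m" "m \<le> l" "1 \<le> r" "1 \<le> c" "c \<le> la' m r" by (auto simp: diagram_def)
  have iff: "c' \<le> la' m r' \<longleftrightarrow> c' \<le> la m r' \<or> (r', c') = (r, c)" if "1 \<le> r'" "1 \<le> c'" for r' c'
    using m that in_diagram_iff[of m l r' c'] eq by (metis Un_iff Pair_inject singleton_iff)
  have "la m r < c" using D m by (auto simp: diagram_def)
  then have c: "c = la m r + 1" using iff[of r "la m r + 1"] m by simp
  have "la m r < la m (r - 1)" if "r \<noteq> 1"
  proof -
    have "1 < r" using that m(3) by linarith
    then have "c \<le> la' m (r - 1)" using multipartition_pred_le[OF la' m(1,2), of r] m by linarith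
    moreover have "1 \<le> r - 1" "r - 1 \<noteq> r" using \<open>1 < r\<close> by linarith+
    ultimately show ?thesis using iff[of "r - 1" c] m c by simp
  qed
  then show "(m, r) \<in> addable_rows l la \<and> c = la m r + 1"
    using m c by (auto simp: addable_rows_def)
next
  assume a: "(m, r) \<in> addable_rows l la \<and> c = la m r + 1"
  define la' where "la' = la(m := (la m)(r := c))"
  have "multipartition l la'"
    using a multipartition_Suc_le[OF la, of m r] unfolding la'_def
    by (intro multipartition_upd[OF la]) (auto simp: addable_rows_def)
  moreover have "diagram l la \<union> {(m, r, c)} = diagram l la'"
    using a by (auto simp: la'_def diagram_def addable_rows_def split: if_splits)
  moreover have "(m, r, c) \<notin> diagram l la" using a by (simp add: diagram_def)
  ultimately show "addable l (diagram l la) (m, r, c)"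
    unfolding addable_def is_diagram_def by metis
qed

text \<open>Both sets of nodes are images of sets of rows under injective maps. The column
  \<open>0\<close> in \<open>below (m, r, 0) A\<close> is a dummy, since \<open>below\<close>
  compares only components and rows.\<close>

lemma node_degree_diagram:
  assumes la: "multipartition l la"
  shows "node_degree e kap l (diagram l la) A =
    int (card {(m, r). (m, r) \<in> addable_rows l la \<and>
                res e kap (m, r, la m r + 1) = res e kap A \<and> below (m, r, 0) A}) -
    int (card {(m, r). (m, r) \<in> removable_rows l la \<and>
                res e kap (m, r, la m r) = res e kap A \<and> below (m, r, 0) A})"
proof -
  have below: "below (m, r, la m r) A \<longleftrightarrow> below (m, r, 0) A"
    "below (m, r, Suc (la m r)) A \<longleftrightarrow> below (m, r, 0) A" for m r
    by (cases A, simp)+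
  let ?P = "{(m, r). (m, r) \<in> addable_rows l la \<and>
                res e kap (m, r, la m r + 1) = res e kap A \<and> below (m, r, 0) A}"
  let ?Q = "{(m, r). (m, r) \<in> removable_rows l la \<and>
                res e kap (m, r, la m r) = res e kap A \<and> below (m, r, 0) A}"
  have "{B. addable l (diagram l la) B \<and> res e kap B = res e kap A \<and> below B A}
      = (\<lambda>(m, r). (m, r, la m r + 1)) ` ?P"
    by (auto simp: below addable_iff[OF la] image_iff)
  moreover have "inj_on (\<lambda>(m, r). (m, r, la m r + 1)) ?P" by (auto simp: inj_on_def)
  moreover have "{B. removable l (diagram l la) B \<and> res e kap B = res e kap A \<and> below B A}
      = (\<lambda>(m, r). (m, r, la m r)) ` ?Q"
    by (auto simp: below removable_iff[OF la] image_iff)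
  moreover have "inj_on (\<lambda>(m, r). (m, r, la m r)) ?Q" by (auto simp: inj_on_def)
  ultimately show ?thesis by (simp add: node_degree_def card_image)
qed

section \<open>Stretching rows\<close>

locale subdivision =
  fixes e k :: int and l :: nat and kap :: charge
  assumes k_range: "0 \<le> k" "k < e"
    and charge_range: "1 \<le> m \<Longrightarrow> m \<le> l \<Longrightarrow> 0 \<le> kap m \<and> kap m < e"
begin

abbreviation rs :: "nat \<Rightarrow> nat \<Rightarrow> nat \<Rightarrow> int" where
  "rs m r c \<equiv> res e kap (m, r, c)"

abbreviation kap' :: charge where
  "kap' \<equiv> subdiv_charge k kap"

abbreviation rs' :: "nat \<Rightarrow> nat \<Rightarrow> nat \<Rightarrow> int" where
  "rs' m r c \<equiv> res (e + 1) kap' (m, r, c)"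

text \<open>On \<open>{0..<e}\<close> this is the injection into \<open>{0..e}\<close> that misses
  exactly \<open>k + 1\<close>; applied to the charge it is \<open>subdiv_charge\<close>.\<close>

definition skip :: "int \<Rightarrow> int" where
  "skip i = (if i \<le> k then i else i + 1)"

text \<open>
  \<open>len m r c\<close> is the length to which the first \<open>c\<close> columns of row \<open>r\<close> of component \<open>m\<close> are
  stretched by the subdivision, so that \<open>A\<^sup>+\<close> is in column \<open>len m r c + 1\<close> for \<open>A = (m, r, c + 1)\<close>.
\<close>

primrec len :: "nat \<Rightarrow> nat \<Rightarrow> nat \<Rightarrow> nat" where
  "len m r 0 = 0"
| "len m r (Suc c) = len m r c + (if rs m r (Suc c) = k then 2 else 1)"

section \<open>Residues along stretched rows\<close>

lemma rs_range: "0 \<le> rs m r c" "rs m r c < e"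
  using k_range by (auto simp: res.simps)

lemma rs_Suc_Suc: "rs m (Suc r) (Suc c) = rs m r c"
  by (simp add: res.simps add_diff_eq)

lemma rs_Suc: "rs m r (Suc c) = (if rs m r c = e - 1 then 0 else rs m r c + 1)"
proof -
  have "rs m r (Suc c) = (rs m r c + 1) mod e"
    by (simp add: res.simps mod_simps add_diff_eq ac_simps)
  then show ?thesis using rs_range[of m r c] by (auto simp: mod_pos_pos_trivial)
qed

lemma rs'_range: "0 \<le> rs' m r c" "rs' m r c < e + 1"
  unfolding res.simps using k_range by (intro pos_mod_sign pos_mod_bound; linarith)+

lemma rs'_Suc: "rs' m r (Suc c) = (if rs' m r c = e then 0 else rs' m r c + 1)"
proof -
  have "rs' m r (Suc c) = (rs' m r c + 1) mod (e + 1)"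
    by (simp add: res.simps mod_simps add_diff_eq ac_simps)
  then show ?thesis using rs'_range[of m r c] by (auto simp: mod_pos_pos_trivial)
qed

lemma rs'_Suc_Suc: "rs' m (Suc r) (Suc c) = rs' m r c"
  by (simp add: res.simps add_diff_eq)

text \<open>A step to the right raises the residue by one. Crossing a \<open>k\<close>-node takes
  two steps in the stretched row, which is just what jumps over \<open>k + 1\<close>; every other
  node takes one. The wrap-around goes from \<open>e - 1\<close> to \<open>0\<close> on one side and
  from \<open>e\<close> to \<open>0\<close> on the other.\<close>

lemma rs'_len:
  assumes "rs' m r 1 = skip (rs m r 1)"
  shows "rs' m r (len m r c + 1) = skip (rs m r (Suc c))"
proof (induction c)
  case (Suc c)
  then show ?case
    using rs'_Suc[of m r "len m r c + 1"] rs'_Suc[of m r "len m r c + 2"]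
      rs_Suc[of m r "Suc c"] rs_range[of m r "Suc c"] k_range
    by (auto simp: skip_def split: if_splits)
qed (use assms in simp)

text \<open>In row 1 the shifted charge is the relabelled charge. A step down lowers both residues
  by one and respects \<open>skip\<close> unless it would land on \<open>k\<close>, which the last
  hypothesis excludes.\<close>

lemma rs'_first:
  assumes m: "1 \<le> m" "m \<le> l" and "1 \<le> r"
    and "\<And>r'. 2 \<le> r' \<Longrightarrow> r' \<le> r \<Longrightarrow> rs m r' 1 \<noteq> k"
  shows "rs' m r 1 = skip (rs m r 1)"
  using assms(3,4)
proof (induction r rule: dec_induct)
  case base
  then show ?case
    using charge_range[OF m] k_range
    by (auto simp: skip_def res.simps subdiv_charge_def mod_pos_pos_trivial)
next
  case (step r)
  then have "rs' m r 1 = skip (rs m r 1)" "rs m (Suc r) 1 \<noteq> k" by auto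
  \<comment> \<open>The step down is read as a step to the left: on its diagonal, the first node of
    row \<open>r\<close> has the residue of the second node of row \<open>Suc r\<close>.\<close>
  then show ?case
    using rs_Suc[of m "Suc r" 1] rs'_Suc[of m "Suc r" 1] rs_Suc_Suc[of m r 1]
      rs'_Suc_Suc[of m r 1] rs_range[of m "Suc r" 1] rs'_range[of m "Suc r" 1] k_range
    by (auto simp: skip_def split: if_splits)
qed

text \<open>
  The only position where the relabelling of residues fails: the first empty row, if it would start
  with a \<open>k\<close>-node.
\<close>

lemma rs'_first_Suc_k:
  assumes "rs' m r 1 = skip (rs m r 1)" and "rs m (Suc r) 1 = k"
  shows "rs' m (Suc r) 1 = k + 1"
  using assms rs_Suc[of m "Suc r" 1] rs'_Suc[of m "Suc r" 1] rs_Suc_Suc[of m r 1]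
    rs'_Suc_Suc[of m r 1] rs_range[of m "Suc r" 1] rs'_range[of m "Suc r" 1] k_range
  by (auto simp: skip_def split: if_splits)

lemma skip_inject: "skip i = skip j \<longleftrightarrow> i = j"
  by (auto simp: skip_def)

lemma skip_eq_k: "skip i = k \<longleftrightarrow> i = k"
  by (auto simp: skip_def)

lemma skip_neq_Suc_k: "skip i \<noteq> k + 1" "k + 1 \<noteq> skip i"
  by (auto simp: skip_def)

section \<open>Lengths of stretched rows\<close>

lemma len_strict_mono: "c < c' \<Longrightarrow> len m r c < len m r c'"
  by (induction c') (auto simp: less_Suc_eq)

lemma len_mono: "c \<le> c' \<Longrightarrow> len m r c \<le> len m r c'"
  using len_strict_mono[of c c' m r] by (cases "c = c'") auto

text \<open>Residues are constant along diagonals, so row \<open>Suc r\<close> reads as row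
  \<open>r\<close> with one node put in front. As that node is not a \<open>k\<close>-node, it
  contributes a single column.\<close>

lemma len_Suc_row:
  assumes "rs m (Suc r) 1 \<noteq> k"
  shows "len m (Suc r) (Suc c) = len m r c + 1"
  by (induction c) (use assms in \<open>auto simp: rs_Suc_Suc\<close>)

lemma len_eq_card: "len m r c = c + card {x. 1 \<le> x \<and> x \<le> c \<and> rs m r x = k}"
proof (induction c)
  case (Suc c)
  have "{x. 1 \<le> x \<and> x \<le> Suc c \<and> rs m r x = k} =
    (if rs m r (Suc c) = k then insert (Suc c) {x. 1 \<le> x \<and> x \<le> c \<and> rs m r x = k}
     else {x. 1 \<le> x \<and> x \<le> c \<and> rs m r x = k})"
    by (auto simp: le_Suc_eq)
  then show ?case using Suc by simp
qed simp

text \<open>The two cases are the columns of \<open>plus_node\<close> and \<open>sharp_node\<close>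
  for the node in column \<open>Suc c\<close>.\<close>

lemma len_cover:
  assumes "1 \<le> C" "C \<le> len m r a"
  obtains c where "c < a" "C = len m r c + 1"
  | c where "c < a" "rs m r (Suc c) = k" "C = len m r c + 2"
  using assms(2)
proof (induction a)
  case 0 then show ?case using assms by simp
next
  case (Suc a)
  consider "C \<le> len m r a" | "C = len m r a + 1" | "C = len m r a + 2" "rs m r (Suc a) = k"
    using Suc.prems(3) by (fastforce split: if_splits)
  then show ?case
  proof cases
    case 1 then show ?thesis using Suc.IH Suc.prems by (meson less_Suc_eq)
  qed (use Suc.prems in auto)
qed

end

section \<open>The subdivided shape\<close>

locale horizontal_shape = subdivision +
  fixes la :: shape
  assumes multipartition_la: "multipartition l la"
    and horizontal_la: "horizontal e kap l k la"
begin

abbreviation mu :: shape where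
  "mu \<equiv> subdiv_shape e kap l k la"

text \<open>Horizontality forbids residue \<open>k + 1\<close> at the start of the upper of two
  nonempty rows. One row down this is residue \<open>k\<close>; for \<open>k = e - 1\<close> the
  residue above is \<open>0\<close>, which is congruent to \<open>k + 1\<close>.\<close>

lemma rs_first_neq_k:
  assumes m: "1 \<le> m" "m \<le> l" and r: "1 \<le> r" and nonempty: "1 \<le> la m (Suc r)"
  shows "rs m (Suc r) 1 \<noteq> k"
proof
  assume "rs m (Suc r) 1 = k"
  then have "rs m r 1 = (if k = e - 1 then 0 else k + 1)"
    using rs_Suc[of m "Suc r" 1] rs_Suc_Suc[of m r 1] by (simp del: One_nat_def split: if_splits)
  then have "[rs m r 1 = k + 1] (mod e)"
    using k_range by (auto simp: cong_def)
  moreover have "1 \<le> la m r"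
    using multipartition_Suc_le[OF multipartition_la m r] nonempty by simp
  ultimately show False
    using horizontal_la m r nonempty
    by (auto simp: horizontal_def diagram_def)
qed

lemma rs'_first_nonempty:
  assumes m: "1 \<le> m" "m \<le> l" and r: "1 \<le> r" and nonempty: "r = 1 \<or> 1 \<le> la m r"
  shows "rs' m r 1 = skip (rs m r 1)"
proof (rule rs'_first[OF m r])
  fix r' assume r': "2 \<le> r'" "r' \<le> r"
  then have "1 \<le> la m r'"
    using multipartition_antimono[OF multipartition_la m, of r' r] nonempty by simp
  then show "rs m r' 1 \<noteq> k" using rs_first_neq_k[OF m, of "r' - 1"] r' by simp
qed

text \<open>Row \<open>Suc r\<close> may be empty here. Horizontality then allows its first position
  to have residue \<open>k\<close>, which is where the exceptional value \<open>k + 1\<close>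
  arises.\<close>

lemma rs'_first_addable:
  assumes m: "1 \<le> m" "m \<le> l" and r: "1 \<le> r" and nonempty: "1 \<le> la m r"
  shows "rs' m (Suc r) 1 = (if rs m (Suc r) 1 = k then k + 1 else skip (rs m (Suc r) 1))"
proof -
  have "rs m r' 1 \<noteq> k" if r': "2 \<le> r'" "r' \<le> r" for r'
  proof -
    have "1 \<le> la m r'"
      using multipartition_antimono[OF multipartition_la m, of r' r] nonempty r' by simp
    then show ?thesis using rs_first_neq_k[OF m, of "r' - 1"] r' by simp
  qed
  then have "rs' m (Suc r) 1 = skip (rs m (Suc r) 1)" if "rs m (Suc r) 1 \<noteq> k"
    using that by (intro rs'_first[OF m]) (auto simp: le_Suc_eq)
  then show ?thesis
    using rs'_first_Suc_k rs'_first_nonempty[OF m r] nonempty by auto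
qed

section \<open>Row lengths of the subdivided shape\<close>

lemma mu_eq_len:
  assumes "1 \<le> m" "m \<le> l" "1 \<le> r"
  shows "mu m r = len m r (la m r)"
proof -
  have "{c. (m, r, c) \<in> diagram l la \<and> rs m r c = k}
      = {c. 1 \<le> c \<and> c \<le> la m r \<and> rs m r c = k}"
    using assms by (auto simp: diagram_def)
  then show ?thesis by (simp add: subdiv_shape_def len_eq_card)
qed

lemma mu_Suc_row:
  assumes m: "1 \<le> m" "m \<le> l" "1 \<le> r" and "la m (Suc r) = Suc b"
  shows "mu m (Suc r) = len m r b + 1"
  using assms rs_first_neq_k[OF m] len_Suc_row[of m r b] mu_eq_len[of m "Suc r"]
  by (simp del: len.simps)

text \<open>If row \<open>Suc r\<close> has length \<open>Suc b\<close>, its stretched length is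
  \<open>len m r b + 1\<close> by the diagonal shift. A longer row \<open>r\<close> stays strictly
  longer, and a row \<open>r\<close> of equal length gets ahead by one exactly when its last node is
  a \<open>k\<close>-node.\<close>

lemma mu_less_iff:
  assumes m: "1 \<le> m" "m \<le> l" "1 \<le> r"
  shows "mu m (Suc r) < mu m r \<longleftrightarrow> la m (Suc r) < la m r \<or>
    1 \<le> la m r \<and> la m (Suc r) = la m r \<and> rs m r (la m r) = k"
    and "mu m (Suc r) \<le> mu m r"
proof -
  let ?P = "(mu m (Suc r) < mu m r \<longleftrightarrow> la m (Suc r) < la m r \<or>
    1 \<le> la m r \<and> la m (Suc r) = la m r \<and> rs m r (la m r) = k) \<and> mu m (Suc r) \<le> mu m r"
  have "?P"
  proof (cases "la m (Suc r)")
    case 0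
    then show ?thesis
      using len_strict_mono[of 0 "la m r" m r] mu_eq_len[OF m] mu_eq_len[of m "Suc r"] m
      by auto
  next
    case (Suc b)
    have "b < la m r" using multipartition_Suc_le[OF multipartition_la m] Suc by simp
    moreover have "len m r b + 1 < mu m r" if "Suc b < la m r"
      using len_strict_mono[OF that, of m r] mu_eq_len[OF m] by (simp split: if_splits)
    moreover have "mu m r = len m r (Suc b)" if "la m r = Suc b"
      using that mu_eq_len[OF m] by simp
    ultimately show ?thesis using Suc mu_Suc_row[OF m Suc] by (cases "la m r = Suc b") auto
  qed
  then show "mu m (Suc r) < mu m r \<longleftrightarrow> la m (Suc r) < la m r \<or>
    1 \<le> la m r \<and> la m (Suc r) = la m r \<and> rs m r (la m r) = k" "mu m (Suc r) \<le> mu m r" by auto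
qed

lemma multipartition_mu: "multipartition l mu"
  unfolding multipartition_def
proof (intro ballI conjI allI impI)
  fix m assume m: "m \<in> {1..l}"
  show "mu m (Suc r) \<le> mu m r" if "r \<ge> 1" for r
    using mu_less_iff(2)[of m r] m that by simp
  show "finite {r. 1 \<le> r \<and> mu m r \<noteq> 0}"
    by (rule finite_subset[OF _ multipartition_finite_support[OF multipartition_la, of m]])
      (use m mu_eq_len[of m] in \<open>auto intro!: gr0I\<close>)
qed

section \<open>Residues at the ends of rows\<close>

lemma rs'_end:
  assumes m: "1 \<le> m" "m \<le> l" "1 \<le> r" and "1 \<le> la m r"
  shows "rs' m r (mu m r) = (if rs m r (la m r) = k then k + 1 else skip (rs m r (la m r)))"
proof -
  obtain c where c: "la m r = Suc c" using assms by (cases "la m r") auto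
  have "rs' m r (len m r c + 1) = skip (rs m r (Suc c))"
    by (rule rs'_len) (use rs'_first_nonempty[OF m] assms in auto)
  then show ?thesis
    using c mu_eq_len[OF m] rs'_Suc[of m r "len m r c + 1"] k_range skip_eq_k[of k]
    by auto
qed

lemma rs'_next:
  assumes m: "1 \<le> m" "m \<le> l" "1 \<le> r" and good: "r = 1 \<or> 1 \<le> la m (r - 1)"
  shows "rs' m r (Suc (mu m r)) =
    (if 2 \<le> r \<and> la m r = 0 \<and> rs m r 1 = k then k + 1 else skip (rs m r (Suc (la m r))))"
proof (cases "r = 1 \<or> 1 \<le> la m r")
  case True
  then show ?thesis
    using rs'_len[OF rs'_first_nonempty[OF m], of "la m r"] mu_eq_len[OF m] by auto
next
  case False
  then obtain r' where r': "r = Suc r'" "1 \<le> r'" "1 \<le> la m r'" using m good by (cases r) auto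
  have "la m r = 0" using False by simp
  then show ?thesis
    using r' rs'_first_addable[OF m(1,2), of r'] mu_eq_len[OF m] by simp
qed

text \<open>New addable rows appear under a row of equal length ending in a \<open>k\<close>-node.
  That end lies on the same diagonal as the position after row \<open>r\<close>, which turns the
  condition of \<open>mu_less_iff\<close> into one on row \<open>r\<close> itself.\<close>

lemma addable_rows_mu:
  "(m, r) \<in> addable_rows l mu \<longleftrightarrow> (m, r) \<in> addable_rows l la \<or>
    1 \<le> m \<and> m \<le> l \<and> 2 \<le> r \<and> 1 \<le> la m r \<and> la m r = la m (r - 1) \<and> rs m r (Suc (la m r)) = k"
proof (cases "2 \<le> r")
  case True
  then obtain r' where "r = Suc r'" "1 \<le> r'" by (cases r) auto
  then show ?thesis
    using mu_less_iff(1)[of m r'] rs_Suc_Suc[of m r' "la m r"] by (auto simp: addable_rows_def)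
qed (auto simp: addable_rows_def)

lemma removable_rows_mu:
  "(m, r) \<in> removable_rows l mu \<longleftrightarrow> (m, r) \<in> removable_rows l la \<or>
    1 \<le> m \<and> m \<le> l \<and> 1 \<le> r \<and> 1 \<le> la m r \<and> la m (Suc r) = la m r \<and> rs m r (la m r) = k"
  using mu_less_iff(1)[of m r] by (auto simp: removable_rows_def)

lemma addable_rows_good:
  "(m, r) \<in> addable_rows l mu \<Longrightarrow> 1 \<le> m \<and> m \<le> l \<and> 1 \<le> r \<and> (r = 1 \<or> 1 \<le> la m (r - 1))"
  by (auto simp: addable_rows_mu) (auto simp: addable_rows_def)

lemma removable_rows_good:
  "(m, r) \<in> removable_rows l mu \<Longrightarrow> 1 \<le> m \<and> m \<le> l \<and> 1 \<le> r \<and> 1 \<le> la m r"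
  by (auto simp: removable_rows_mu) (auto simp: removable_rows_def)

lemma addable_residue_skip:
  assumes "(m, r) \<in> addable_rows l mu"
  shows "rs' m r (Suc (mu m r)) = skip i \<longleftrightarrow>
    rs m r (Suc (la m r)) = i \<and> \<not> (2 \<le> r \<and> la m r = 0 \<and> i = k)"
  using rs'_next[of m r] addable_rows_good[OF assms] skip_neq_Suc_k[of i]
  by (cases "2 \<le> r \<and> la m r = 0 \<and> rs m r 1 = k") (auto simp: skip_inject)

lemma addable_residue_Suc_k:
  assumes "(m, r) \<in> addable_rows l mu"
  shows "rs' m r (Suc (mu m r)) = k + 1 \<longleftrightarrow>
    2 \<le> r \<and> la m r = 0 \<and> rs m r (Suc (la m r)) = k"
  using rs'_next[of m r] addable_rows_good[OF assms]
  by (cases "2 \<le> r \<and> la m r = 0 \<and> rs m r 1 = k") (auto simp: skip_neq_Suc_k)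

text \<open>A row ending in a \<open>k\<close>-node ends after subdivision in the inserted node of
  residue \<open>k + 1\<close>. Hence for \<open>i = k\<close> both sides are false.\<close>

lemma removable_residue_skip:
  assumes "(m, r) \<in> removable_rows l mu"
  shows "rs' m r (mu m r) = skip i \<longleftrightarrow> rs m r (la m r) = i \<and> i \<noteq> k"
  using rs'_end[of m r] removable_rows_good[OF assms] skip_neq_Suc_k[of i]
  by (cases "rs m r (la m r) = k") (auto simp: skip_inject)

lemma removable_residue_Suc_k:
  assumes "(m, r) \<in> removable_rows l mu"
  shows "rs' m r (mu m r) = k + 1 \<longleftrightarrow> rs m r (la m r) = k"
  using rs'_end[of m r] removable_rows_good[OF assms] skip_neq_Suc_k by auto

text \<open>The additional addable and removable rows of \<open>mu\<close>, as well as the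
  exceptional empty row, all come from residue \<open>k\<close> in \<open>la\<close>. For any other
  residue the row sets on the two sides coincide.\<close>

lemma node_degree_non_k:
  assumes i: "rs m0 r0 c0 \<noteq> k" and C0: "rs' m0 r0 C0 = skip (rs m0 r0 c0)"
  shows "node_degree e kap l (diagram l la) (m0, r0, c0) =
    node_degree (e + 1) kap' l (diagram l mu) (m0, r0, C0)"
proof -
  have "(m, r) \<in> addable_rows l mu \<and> rs' m r (Suc (mu m r)) = rs' m0 r0 C0 \<longleftrightarrow>
      (m, r) \<in> addable_rows l la \<and> rs m r (Suc (la m r)) = rs m0 r0 c0" for m r
    unfolding C0 using addable_residue_skip[of m r] addable_rows_mu[of m r] i by metis
  moreover have "(m, r) \<in> removable_rows l mu \<and> rs' m r (mu m r) = rs' m0 r0 C0 \<longleftrightarrow>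
      (m, r) \<in> removable_rows l la \<and> rs m r (la m r) = rs m0 r0 c0" for m r
    unfolding C0 using removable_residue_skip[of m r] removable_rows_mu[of m r] i by metis
  ultimately show ?thesis
    by (simp add: node_degree_diagram multipartition_la multipartition_mu flip: conj_assoc)
qed

text \<open>The last node of row \<open>r\<close> is stretched to two columns, both beyond the end
  of the row below. Thus row \<open>Suc r\<close> is addable before and after one node is taken from
  row \<open>r\<close>.\<close>

lemma mu_gap:
  assumes A: "(m, r) \<in> removable_rows l la" "rs m r (la m r) = k"
  shows "mu m (Suc r) + 1 < mu m r"
proof -
  have m: "1 \<le> m" "m \<le> l" "1 \<le> r" using A by (auto simp: removable_rows_def)
  obtain c where c: "la m r = Suc c" using A by (cases "la m r") (auto simp: removable_rows_def)
  have mu: "mu m r = len m r c + 2" using mu_eq_len[OF m] A c by simp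
  show ?thesis
  proof (cases "la m (Suc r)")
    case 0
    then show ?thesis using mu mu_eq_len[of m "Suc r"] m by simp
  next
    case (Suc b)
    then have "b < c" using A c by (simp add: removable_rows_def)
    then show ?thesis using mu mu_Suc_row[OF m Suc] len_strict_mono[of b c m r] by simp
  qed
qed

text \<open>With the sets named in the proof, removing the inserted node contributes
  \<open>card S - card (Rl \<union> X)\<close> and removing its left neighbour contributes
  \<open>card (U \<union> X')\<close>. As \<open>Al\<close> splits into \<open>S\<close> and
  \<open>U\<close>, and \<open>X'\<close> is \<open>X\<close> moved down a row, the sum is
  \<open>card Al - card Rl\<close>.\<close>

lemma node_degree_k:
  assumes A: "(m0, r0) \<in> removable_rows l la" and k: "rs m0 r0 (la m0 r0) = k"
    and c0: "rs m0 r0 c0 = k" and C0: "rs' m0 r0 C0 = k" and C1: "rs' m0 r0 C1 = k + 1"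
  shows "node_degree e kap l (diagram l la) (m0, r0, c0) =
    node_degree (e + 1) kap' l (diagram l mu) (m0, r0, C1) +
    node_degree (e + 1) kap' l (diagram l (dec_row mu m0 r0)) (m0, r0, C0)"
proof -
  define mu' where "mu' = dec_row mu m0 r0"
  define L where "L = (\<lambda>m r. m0 < m \<or> m = m0 \<and> r0 < r)"
  have A': "(m0, r0) \<in> removable_rows l mu" using A removable_rows_mu by blast
  have mp': "multipartition l mu'"
    unfolding mu'_def by (rule multipartition_dec_row[OF multipartition_mu A'])
  have L_mu': "mu' m r = mu m r" if "L m r" for m r
    using that by (auto simp: mu'_def dec_row_def L_def)
  \<comment> \<open>Addability of a row compares it with the row above, so shortening row
    \<open>r0\<close> can affect only row \<open>Suc r0\<close>; there \<open>mu_gap\<close> settles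
    the matter.\<close>
  have add': "(m, r) \<in> addable_rows l mu' \<longleftrightarrow> (m, r) \<in> addable_rows l mu" if "L m r" for m r
  proof (cases "m = m0 \<and> r = Suc r0")
    case True
    then show ?thesis using mu_gap[OF A k] A L_mu'[OF that]
      by (auto simp: addable_rows_def removable_rows_def mu'_def dec_row_def)
  next
    case False
    then have "mu' m (r - 1) = mu m (r - 1)" using that by (auto simp: mu'_def dec_row_def L_def)
    then show ?thesis using L_mu'[OF that] by (simp add: addable_rows_def)
  qed
  have rem': "(m, r) \<in> removable_rows l mu' \<longleftrightarrow> (m, r) \<in> removable_rows l mu" if "L m r" for m r
  proof -
    have "L m (Suc r)" using that by (auto simp: L_def)
    then show ?thesis using L_mu' that by (simp add: removable_rows_def)
  qed
  define Al where "Al = {(m, r). (m, r) \<in> addable_rows l la \<and> rs m r (la m r + 1) = k \<and> L m r}"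
  define Rl where "Rl = {(m, r). (m, r) \<in> removable_rows l la \<and> rs m r (la m r) = k \<and> L m r}"
  \<comment> \<open>\<open>S\<close> is the exceptional first empty row, whose addable \<open>k\<close>-node becomes a \<open>(k + 1)\<close>-node;
    \<open>X\<close> and \<open>X'\<close> are the new removable and addable nodes that cancel.\<close>
  define S where "S = {(m, r). (m, r) \<in> Al \<and> 2 \<le> r \<and> la m r = 0}"
  define U where "U = Al - S"
  define X where "X = {(m, r). 1 \<le> m \<and> m \<le> l \<and> 1 \<le> r \<and> 1 \<le> la m r \<and>
    la m (Suc r) = la m r \<and> rs m r (la m r) = k \<and> L m r}"
  define X' where "X' = (\<lambda>(m, r). (m, Suc r)) ` X"
  have X': "(m, r) \<in> X' \<longleftrightarrow> 1 \<le> m \<and> m \<le> l \<and> 2 \<le> r \<and> 1 \<le> la m r \<and>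
    la m r = la m (r - 1) \<and> rs m r (Suc (la m r)) = k \<and> L m r" for m r
  proof (cases "2 \<le> r")
    case True
    then obtain r' where r': "r = Suc r'" "1 \<le> r'" by (cases r) auto
    \<comment> \<open>The two conditions differ only for \<open>r' = r0\<close>, but a removable row
      is strictly longer than the one below it.\<close>
    have "L m r' \<longleftrightarrow> L m r" if "la m r = la m r'"
      using that r' A by (auto simp: L_def less_Suc_eq removable_rows_def)
    then show ?thesis using r' by (auto simp: X'_def X_def image_iff rs_Suc_Suc)
  qed (auto simp: X'_def X_def)
  have A1: "{(m, r). (m, r) \<in> addable_rows l mu \<and> rs' m r (mu m r + 1) = k + 1 \<and> L m r} = S"
  proof -
    have "(m, r) \<in> addable_rows l mu \<and> rs' m r (Suc (mu m r)) = k + 1 \<longleftrightarrow>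
      (m, r) \<in> addable_rows l la \<and> rs m r (Suc (la m r)) = k \<and> 2 \<le> r \<and> la m r = 0" for m r
      using addable_residue_Suc_k[of m r] addable_rows_mu[of m r] by (metis not_one_le_zero)
    then show ?thesis by (auto simp: S_def Al_def)
  qed
  have R1: "{(m, r). (m, r) \<in> removable_rows l mu \<and> rs' m r (mu m r) = k + 1 \<and> L m r} = Rl \<union> X"
  proof -
    have "(m, r) \<in> removable_rows l mu \<and> rs' m r (mu m r) = k + 1 \<and> L m r \<longleftrightarrow>
      (m, r) \<in> Rl \<union> X" for m r
      unfolding Rl_def X_def Un_iff mem_Collect_eq prod.case
      using removable_residue_Suc_k[of m r] removable_rows_mu[of m r] by blast
    then show ?thesis by auto
  qed
  have skip_k: "skip k = k" by (simp add: skip_eq_k)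
  have A2: "{(m, r). (m, r) \<in> addable_rows l mu' \<and> rs' m r (mu' m r + 1) = k \<and> L m r} = U \<union> X'"
  proof -
    have "(m, r) \<in> addable_rows l mu' \<and> rs' m r (Suc (mu' m r)) = k \<and> L m r \<longleftrightarrow>
      (m, r) \<in> U \<union> X'" for m r
    proof -
      have "(m, r) \<in> addable_rows l mu' \<and> rs' m r (Suc (mu' m r)) = k \<and> L m r \<longleftrightarrow>
        (m, r) \<in> addable_rows l mu \<and> rs m r (Suc (la m r)) = k \<and>
          \<not> (2 \<le> r \<and> la m r = 0) \<and> L m r"
        using add'[of m r] L_mu'[of m r] addable_residue_skip[of m r k] skip_k by metis
      also have "\<dots> \<longleftrightarrow> (m, r) \<in> U \<union> X'"
        unfolding Un_iff X' addable_rows_mu U_def S_def Al_def Diff_iff mem_Collect_eq prod.case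
        by auto
      finally show ?thesis .
    qed
    then show ?thesis by auto
  qed
  have R2: "{(m, r). (m, r) \<in> removable_rows l mu' \<and> rs' m r (mu' m r) = k \<and> L m r} = {}"
  proof -
    have "\<not> ((m, r) \<in> removable_rows l mu \<and> rs' m r (mu m r) = k)" for m r
      using removable_residue_skip[of m r k] skip_k by metis
    then show ?thesis using rem' L_mu' by auto
  qed
  have "Al \<subseteq> addable_rows l la" "Rl \<subseteq> removable_rows l la"
    by (auto simp: Al_def Rl_def)
  moreover have "X \<subseteq> removable_rows l mu"
    unfolding X_def using removable_rows_mu by blast
  ultimately have fin: "finite Al" "finite Rl" "finite X"
    using finite_addable_rows finite_removable_rows multipartition_la multipartition_mu
    by (meson finite_subset)+
  have "S \<subseteq> Al" by (auto simp: S_def)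
  then have "card Al = card S + card U"
    unfolding U_def using fin(1) card_mono[of Al S]
    by (simp add: card_Diff_subset finite_subset)
  moreover have "card (Rl \<union> X) = card Rl + card X"
    using fin by (intro card_Un_disjoint) (auto simp: Rl_def X_def removable_rows_def)
  moreover have "card (U \<union> X') = card U + card X'"
  proof (rule card_Un_disjoint)
    show "finite U" "finite X'" using fin by (auto simp: U_def X'_def)
    show "U \<inter> X' = {}" by (auto simp: U_def Al_def X' addable_rows_def)
  qed
  moreover have "card X' = card X"
    unfolding X'_def by (rule card_image) (auto simp: inj_on_def)
  ultimately have "int (card Al) - int (card Rl) =
    (int (card S) - int (card (Rl \<union> X))) + (int (card (U \<union> X')) - int (card {}))"
    by simp
  then show ?thesis
    unfolding mu'_def[symmetric]
    using A1 R1 A2 arg_cong[OF R2, of card]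
    by (simp add: node_degree_diagram multipartition_la multipartition_mu mp' c0 C0 C1
        Al_def Rl_def L_def conj_commute)
qed

end

section \<open>The subdivided tableau\<close>

text \<open>The subdivided tableaux of a shape and of the shape with a node removed are different
  total functions that agree only on the smaller diagram.\<close>

lemma degree_rec_cong:
  assumes "\<And>A. A \<in> D \<Longrightarrow> T A = T' A"
  shows "degree_rec e kap l T n D = degree_rec e kap l T' n D"
  using assms
proof (induction n arbitrary: D)
  case (Suc n)
  have "inv_into D T (Suc n) = inv_into D T' (Suc n)"
    unfolding inv_into_def using Suc.prems by (metis (no_types, lifting))
  moreover have "degree_rec e kap l T n (D - {A}) = degree_rec e kap l T' n (D - {A})" for A
    using Suc.prems by (intro Suc.IH) auto
  ultimately show ?case by simp
qed simp

locale horizontal_tableau = horizontal_shape +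
  fixes T :: "node \<Rightarrow> nat"
  assumes standard_T: "standard_tableau (diagram l la) T"
begin

abbreviation D :: "node set" where
  "D \<equiv> diagram l la"

abbreviation phi :: "nat \<Rightarrow> nat" where
  "phi \<equiv> subdiv_entry e kap k D T"

abbreviation F :: "node \<Rightarrow> nat" where
  "F \<equiv> subdiv_tableau e kap k D T"

definition k_entry :: "nat \<Rightarrow> bool" where
  "k_entry t \<longleftrightarrow> res e kap (inv_into D T t) = k"

lemma finite_D: "finite D"
  by (rule finite_diagram[OF multipartition_la])

lemma bij_T: "bij_betw T D {1..card D}"
  using standard_T by (simp add: standard_tableau_def tableau_def)

lemma inv_into_T: "A \<in> D \<Longrightarrow> inv_into D T (T A) = A"
  using bij_T by (simp add: bij_betw_def)

lemma T_range: "A \<in> D \<Longrightarrow> 1 \<le> T A \<and> T A \<le> card D"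
  using bij_betwE[OF bij_T] by auto

lemma T_row: "(m, r, c) \<in> D \<Longrightarrow> (m, r, c') \<in> D \<Longrightarrow> c < c' \<Longrightarrow> T (m, r, c) < T (m, r, c')"
  using standard_T by (auto simp: standard_tableau_def)

lemma T_column: "(m, r, c) \<in> D \<Longrightarrow> (m, r', c) \<in> D \<Longrightarrow> r < r' \<Longrightarrow> T (m, r, c) < T (m, r', c)"
  using standard_T by (auto simp: standard_tableau_def)

lemma k_entry_T: "A \<in> D \<Longrightarrow> k_entry (T A) \<longleftrightarrow> res e kap A = k"
  by (simp add: k_entry_def inv_into_T)

section \<open>Renumbering of the entries\<close>

lemma phi_Suc:
  assumes "1 \<le> t"
  shows "phi (Suc t) = phi t + (if k_entry t then 2 else 1)"
proof -
  have "{j. 1 \<le> j \<and> j < Suc t \<and> k_entry j} =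
    (if k_entry t then insert t {j. 1 \<le> j \<and> j < t \<and> k_entry j}
     else {j. 1 \<le> j \<and> j < t \<and> k_entry j})"
    using assms by (auto simp: less_Suc_eq)
  then show ?thesis by (simp add: subdiv_entry_def flip: k_entry_def)
qed

text \<open>The summand 1 reserves the value \<open>phi t + 1\<close> for the inserted node of a
  \<open>k\<close>-entry \<open>t\<close>.\<close>

lemma phi_less:
  assumes "1 \<le> t" "t < t'"
  shows "phi t + (if k_entry t then 1 else 0) < phi t'"
  using assms(2)
proof (induction t')
  case (Suc t')
  then show ?case using phi_Suc[of t'] assms by (cases "t = t'") (auto split: if_splits)
qed simp

lemma card_k_nodes: "card {j. 1 \<le> j \<and> j \<le> card D \<and> k_entry j} = card {A \<in> D. res e kap A = k}"
proof -
  have "{j. 1 \<le> j \<and> j \<le> card D \<and> k_entry j} = T ` {A \<in> D. res e kap A = k}"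
  proof (intro set_eqI iffI)
    fix j assume "j \<in> {j. 1 \<le> j \<and> j \<le> card D \<and> k_entry j}"
    then have "j \<in> T ` D" "k_entry j" using bij_T by (auto simp: bij_betw_def)
    then show "j \<in> T ` {A \<in> D. res e kap A = k}" using k_entry_T by auto
  qed (use T_range k_entry_T in auto)
  moreover have "inj_on T {A \<in> D. res e kap A = k}"
    using bij_T by (auto simp: bij_betw_def intro: inj_on_subset)
  ultimately show ?thesis by (simp add: card_image)
qed

section \<open>Nodes of the subdivided diagram and their entries\<close>

lemma plus_node_eq:
  assumes "(m, r, Suc c) \<in> D"
  shows "plus_node e kap k D (m, r, Suc c) = (m, r, Suc (len m r c))"
proof -
  have "{x. x < Suc c \<and> (m, r, x) \<in> D \<and> rs m r x = k} = {x. 1 \<le> x \<and> x \<le> c \<and> rs m r x = k}"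
    using assms by (auto simp: diagram_def)
  then show ?thesis by (simp add: len_eq_card)
qed

lemma sharp_node_eq:
  assumes "(m, r, Suc c) \<in> D"
  shows "sharp_node e kap k D (m, r, Suc c) = (m, r, Suc (Suc (len m r c)))"
  using plus_node_eq[OF assms] by (simp add: sharp_node_def)

lemma F_plus:
  assumes "(m, r, Suc c) \<in> D"
  shows "F (m, r, Suc (len m r c)) = phi (T (m, r, Suc c))"
  using subdiv_tableau_plus[OF assms, of e kap k T] plus_node_eq[OF assms] by simp

lemma F_sharp:
  assumes "(m, r, Suc c) \<in> D" "rs m r (Suc c) = k"
  shows "F (m, r, Suc (Suc (len m r c))) = Suc (phi (T (m, r, Suc c)))"
  using subdiv_tableau_sharp[OF assms, of T] sharp_node_eq[OF assms(1)] by simp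

lemma mu_cases:
  assumes "(m, r, C) \<in> diagram l mu"
  obtains (plus) c where "(m, r, Suc c) \<in> D" "C = Suc (len m r c)"
  | (sharp) c where "(m, r, Suc c) \<in> D" "rs m r (Suc c) = k" "C = Suc (Suc (len m r c))"
proof -
  have m: "1 \<le> m" "m \<le> l" "1 \<le> r" and C: "1 \<le> C" "C \<le> len m r (la m r)"
    using assms mu_eq_len[of m r] by (auto simp: diagram_def)
  show thesis
    using C
  proof (cases rule: len_cover)
    case (1 c) then show ?thesis using m plus[of c] by (simp add: diagram_def)
  next
    case (2 c) then show ?thesis using m sharp[of c] by (simp add: diagram_def)
  qed
qed

lemma plus_in_mu: "(m, r, Suc c) \<in> D \<Longrightarrow> (m, r, Suc (len m r c)) \<in> diagram l mu"
  using mu_eq_len[of m r] len_strict_mono[of c "la m r" m r] by (auto simp: diagram_def)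

lemma sharp_in_mu:
  "(m, r, Suc c) \<in> D \<Longrightarrow> rs m r (Suc c) = k \<Longrightarrow> (m, r, Suc (Suc (len m r c))) \<in> diagram l mu"
  using mu_eq_len[of m r] len_mono[of "Suc c" "la m r" m r] by (auto simp: diagram_def)

text \<open>Both sides are one more than the number of nodes plus the number of
  \<open>k\<close>-nodes. In this form \<open>phi_less\<close> directly bounds the entries of the
  subdivided tableau.\<close>

lemma card_mu: "Suc (card (diagram l mu)) = phi (Suc (card D))"
proof -
  let ?K = "{A \<in> D. res e kap A = k}"
  have "diagram l mu = plus_node e kap k D ` D \<union> sharp_node e kap k D ` ?K"
  proof (intro equalityI subsetI)
    fix B assume B: "B \<in> diagram l mu"
    obtain m r C where B_eq: "B = (m, r, C)" by (cases B)
    show "B \<in> plus_node e kap k D ` D \<union> sharp_node e kap k D ` ?K"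
      using B unfolding B_eq
    proof (cases rule: mu_cases)
      case (plus c)
      then have "(m, r, C) = plus_node e kap k D (m, r, Suc c)" using plus_node_eq by simp
      then show "(m, r, C) \<in> plus_node e kap k D ` D \<union> sharp_node e kap k D ` ?K"
        using plus(1) by (intro UnI1 image_eqI)
    next
      case (sharp c)
      then have "(m, r, C) = sharp_node e kap k D (m, r, Suc c)" using sharp_node_eq by simp
      then show "(m, r, C) \<in> plus_node e kap k D ` D \<union> sharp_node e kap k D ` ?K"
        by (rule UnI2[OF image_eqI]) (use sharp in simp)
    qed
  next
    fix B assume "B \<in> plus_node e kap k D ` D \<union> sharp_node e kap k D ` ?K"
    then obtain A where A: "A \<in> D"
      and B: "B = plus_node e kap k D A \<or> B = sharp_node e kap k D A \<and> res e kap A = k" by auto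
    obtain m r c where A_eq: "A = (m, r, Suc c)"
      using A not0_implies_Suc by (cases A) (fastforce simp: diagram_def)
    show "B \<in> diagram l mu"
      using A B plus_in_mu[of m r c] sharp_in_mu[of m r c] plus_node_eq[of m r c]
        sharp_node_eq[of m r c] unfolding A_eq by metis
  qed
  moreover have "plus_node e kap k D ` D \<inter> sharp_node e kap k D ` ?K = {}"
  proof -
    have "B \<notin> plus_node e kap k D ` D" if "B \<in> sharp_node e kap k D ` ?K" for B
      using that by (elim imageE CollectE conjE) (simp only: sharp_node_not_plus not_False_eq_True)
    then show ?thesis by blast
  qed
  moreover have "inj_on (sharp_node e kap k D) ?K"
  proof (rule inj_onI)
    fix A B assume "sharp_node e kap k D A = sharp_node e kap k D B"
    then have "plus_node e kap k D A = plus_node e kap k D B"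
      unfolding sharp_node_def
      by (cases "plus_node e kap k D A"; cases "plus_node e kap k D B") simp
    then show "A = B" using inj_plus_node[of e kap k D UNIV] by (simp add: inj_eq)
  qed
  ultimately have "card (diagram l mu) = card D + card ?K"
    using finite_D by (simp add: card_Un_disjoint card_image inj_plus_node)
  then show ?thesis
    using card_k_nodes by (simp add: subdiv_entry_def less_Suc_eq_le flip: k_entry_def)
qed

lemma F_cases:
  assumes "B \<in> diagram l mu"
  obtains A where "A \<in> D" "F B = phi (T A)" "B = plus_node e kap k D A"
  | A where "A \<in> D" "k_entry (T A)" "F B = Suc (phi (T A))" "B = sharp_node e kap k D A"
proof -
  obtain m r C where B: "B = (m, r, C)" by (cases B)
  show thesis
    using assms unfolding B
  proof (cases rule: mu_cases)
    case (plus c)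
    then show ?thesis using that(1)[of "(m, r, Suc c)"] F_plus plus_node_eq B by simp
  next
    case (sharp c)
    then show ?thesis
      using that(2)[of "(m, r, Suc c)"] F_sharp sharp_node_eq B by (simp add: k_entry_T)
  qed
qed

text \<open>The flags \<open>b\<close> and \<open>b'\<close> are 1 for inserted nodes and 0 for
  shifted ones; the gaps left by \<open>phi\<close> let an entry determine its source and its
  flag.\<close>

lemma phi_eqD:
  assumes "1 \<le> t" "1 \<le> t'" "phi t + b = phi t' + b'" "b \<le> 1" "b' \<le> 1"
    and "b = 1 \<Longrightarrow> k_entry t" "b' = 1 \<Longrightarrow> k_entry t'"
  shows "t = t' \<and> b = b'"
proof -
  have "\<not> t < t'" using phi_less[of t t'] assms by (cases "b = 1") (auto split: if_splits)
  moreover have "\<not> t' < t" using phi_less[of t' t] assms by (cases "b' = 1") (auto split: if_splits)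
  ultimately show ?thesis using assms(3) by (cases t t' rule: linorder_cases) auto
qed

lemma bij_F: "bij_betw F (diagram l mu) {1..card (diagram l mu)}"
proof -
  have inj: "inj_on F (diagram l mu)"
  proof (rule inj_onI)
    fix B B' assume B: "B \<in> diagram l mu" "B' \<in> diagram l mu" and eq: "F B = F B'"
    have *: "\<exists>A\<in>D. \<exists>b\<le>1. F B = phi (T A) + b \<and> (b = 1 \<longrightarrow> k_entry (T A)) \<and>
      B = (if b = 0 then plus_node e kap k D A else sharp_node e kap k D A)"
      if "B \<in> diagram l mu" for B
      using that
    proof (cases rule: F_cases)
      case (1 A) then show ?thesis by (intro bexI[of _ A] exI[of _ 0]) auto
    next
      case (2 A) then show ?thesis by (intro bexI[of _ A] exI[of _ 1]) auto
    qed
    obtain A b where A: "A \<in> D" "b \<le> 1" "F B = phi (T A) + b" "b = 1 \<Longrightarrow> k_entry (T A)"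
      "B = (if b = 0 then plus_node e kap k D A else sharp_node e kap k D A)"
      using *[OF B(1)] by blast
    obtain A' b' where A': "A' \<in> D" "b' \<le> 1" "F B' = phi (T A') + b'" "b' = 1 \<Longrightarrow> k_entry (T A')"
      "B' = (if b' = 0 then plus_node e kap k D A' else sharp_node e kap k D A')"
      using *[OF B(2)] by blast
    have eqs: "T A = T A' \<and> b = b'"
      using phi_eqD[of "T A" "T A'" b b'] A A' eq T_range[OF A(1)] T_range[OF A'(1)] by simp
    then have "A = A'" using inv_into_T[OF A(1)] inv_into_T[OF A'(1)] by metis
    then show "B = B'" using eqs by (simp only: A(5) A'(5))
  qed
  have "F ` diagram l mu \<subseteq> {1..card (diagram l mu)}"
  proof (rule image_subsetI)
    fix B assume "B \<in> diagram l mu"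
    then show "F B \<in> {1..card (diagram l mu)}"
    proof (cases rule: F_cases)
      case (1 A)
      moreover have "T A \<le> phi (T A)" by (simp add: subdiv_entry_def)
      ultimately show ?thesis
        using phi_less[of "T A" "Suc (card D)"] T_range[of A] card_mu
        by (simp split: if_splits)
    next
      case (2 A)
      then show ?thesis
        using phi_less[of "T A" "Suc (card D)"] T_range[of A] card_mu by simp
    qed
  qed
  \<comment> \<open>Surjectivity by counting: an injective map into a finite set of the same
    size.\<close>
  then have "F ` diagram l mu = {1..card (diagram l mu)}"
    by (intro card_subset_eq) (simp_all add: card_image[OF inj])
  then show ?thesis using inj by (simp add: bij_betw_def)
qed

lemma F_row:
  assumes "(m, r, C) \<in> diagram l mu" "(m, r, C') \<in> diagram l mu" "C < C'"
  shows "F (m, r, C) < F (m, r, C')"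
proof -
  have *: "\<exists>c b. (m, r, Suc c) \<in> D \<and> b \<le> 1 \<and> (b = 1 \<longrightarrow> rs m r (Suc c) = k) \<and>
    C = Suc (len m r c + b) \<and> F (m, r, C) = phi (T (m, r, Suc c)) + b"
    if "(m, r, C) \<in> diagram l mu" for C
    using that
  proof (cases rule: mu_cases)
    case (plus c)
    then show ?thesis using F_plus by (intro exI[of _ c] exI[of _ 0]) simp
  next
    case (sharp c)
    then show ?thesis using F_sharp by (intro exI[of _ c] exI[of _ 1]) simp
  qed
  obtain c b where c: "(m, r, Suc c) \<in> D" "b \<le> 1" "b = 1 \<Longrightarrow> rs m r (Suc c) = k"
    "C = Suc (len m r c + b)" "F (m, r, C) = phi (T (m, r, Suc c)) + b"
    using *[OF assms(1)] by blast
  obtain c' b' where c': "(m, r, Suc c') \<in> D" "b' \<le> 1" "b' = 1 \<Longrightarrow> rs m r (Suc c') = k"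
    "C' = Suc (len m r c' + b')" "F (m, r, C') = phi (T (m, r, Suc c')) + b'"
    using *[OF assms(2)] by blast
  have "\<not> c' < c"
  proof
    assume "c' < c"
    then have "len m r (Suc c') \<le> len m r c" by (intro len_mono) simp
    then show False using c c' assms(3) by (auto split: if_splits)
  qed
  then consider "c = c'" | "c < c'" by linarith
  then show ?thesis
  proof cases
    case 1
    then show ?thesis using c c' assms(3) by simp
  next
    case 2
    then have "phi (T (m, r, Suc c)) + b < phi (T (m, r, Suc c'))"
      using phi_less[of "T (m, r, Suc c)" "T (m, r, Suc c')"] T_row[OF c(1) c'(1)]
        T_range[OF c(1)] k_entry_T[OF c(1)] c(2,3)
      by (cases "b = 1") (auto split: if_splits)
    then show ?thesis using c c' by simp
  qed
qed

text \<open>By the diagonal shift, the node above \<open>(m, Suc r, C)\<close> stems from the node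
  of \<open>la\<close> directly above the source of \<open>(m, Suc r, C)\<close>, or from the left
  neighbour of that node. Either has a smaller entry in \<open>T\<close>, with room for the inserted
  one.\<close>

lemma F_column_Suc:
  assumes B: "(m, Suc r, C) \<in> diagram l mu" and r: "1 \<le> r"
  shows "F (m, r, C) < F (m, Suc r, C)"
proof -
  have up: "(m, r, c) \<in> D" if "(m, Suc r, c) \<in> D" for c
    using that multipartition_Suc_le[OF multipartition_la, of m r] r by (auto simp: diagram_def)
  have first: "rs m (Suc r) 1 \<noteq> k" if "(m, Suc r, c) \<in> D" for c
    using that rs_first_neq_k[of m r] r by (auto simp: diagram_def)
  have less: "phi (T (m, r, c)) + (if rs m r c = k then 1 else 0) < phi (T (m, Suc r, c'))"
    if "(m, Suc r, c') \<in> D" "1 \<le> c" "c \<le> c'" for c c'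
  proof -
    have D: "(m, r, c') \<in> D" "(m, r, c) \<in> D"
      using up[OF that(1)] that(2,3) by (auto simp: diagram_def)
    have "T (m, r, c) \<le> T (m, r, c')"
      using T_row[OF D(2,1)] that(3) by (cases "c = c'") auto
    also have "\<dots> < T (m, Suc r, c')" using T_column[OF D(1) that(1)] by simp
    finally show ?thesis
      using phi_less[of "T (m, r, c)" "T (m, Suc r, c')"] T_range[OF D(2)] k_entry_T[OF D(2)]
      by simp
  qed
  show ?thesis
    using B
  proof (cases rule: mu_cases)
    case (plus c)
    show ?thesis
    proof (cases c)
      case 0
      then show ?thesis
        using plus F_plus[OF plus(1)] F_plus[of m r 0] up[OF plus(1)]
          less[OF plus(1), of "Suc 0"] by simp
    next
      case (Suc c1)
      have C: "C = Suc (Suc (len m r c1))"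
        using plus Suc len_Suc_row[OF first[OF plus(1)]] by simp
      have D: "(m, r, Suc c1) \<in> D" using up[OF plus(1)] Suc by (auto simp: diagram_def)
      show ?thesis
      proof (cases "rs m r (Suc c1) = k")
        case True
        then have "F (m, r, C) = Suc (phi (T (m, r, Suc c1)))" using F_sharp[OF D] C by simp
        then show ?thesis
          using less[OF plus(1), of "Suc c1"] True Suc plus F_plus[OF plus(1)] by simp
      next
        case False
        then have "C = Suc (len m r c)" using C Suc by simp
        then have "F (m, r, C) = phi (T (m, r, Suc c))" using F_plus[OF up[OF plus(1)]] by simp
        then show ?thesis
          using less[OF plus(1), of "Suc c"] plus F_plus[OF plus(1)] by simp
      qed
    qed
  next
    case (sharp c)
    \<comment> \<open>A \<open>k\<close>-node in row \<open>Suc r\<close> cannot stand in the first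
      column, so a left neighbour exists.\<close>
    then obtain c1 where c: "c = Suc c1" using first[OF sharp(1)] by (cases c) auto
    have "rs m r (Suc c1) = k" using sharp(2) c rs_Suc_Suc[of m r "Suc c1"] by simp
    then have "C = Suc (len m r c)"
      using sharp c len_Suc_row[OF first[OF sharp(1)], of c1] by simp
    then have "F (m, r, C) = phi (T (m, r, Suc c))" using F_plus[OF up[OF sharp(1)]] by simp
    then show ?thesis
      using less[OF sharp(1), of "Suc c"] sharp F_sharp[OF sharp(1,2)] by simp
  qed
qed

lemma standard_F: "standard_tableau (diagram l mu) F"
proof -
  have "F (m, r, C) < F (m, r', C)"
    if B: "(m, r, C) \<in> diagram l mu" "(m, r', C) \<in> diagram l mu" and r: "r < r'" for m r r' C
    using Suc_leI[OF r] B(2)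
  proof (induction r' rule: dec_induct)
    case base
    then show ?case using F_column_Suc B(1) by (auto simp: diagram_def)
  next
    case (step n)
    have n: "1 \<le> n" using step.hyps by simp
    then have "(m, n, C) \<in> diagram l mu"
      using step.prems multipartition_Suc_le[OF multipartition_mu, of m n]
      by (auto simp: diagram_def)
    then show ?case using step.IH F_column_Suc[OF step.prems n] by simp
  qed
  then show ?thesis using bij_F F_row unfolding standard_tableau_def tableau_def by blast
qed

end

section \<open>Removing the largest entry\<close>

context horizontal_tableau
begin

text \<open>A node to the right or below would need an entry exceeding the maximum.\<close>

lemma largest_entry:
  assumes n: "card D = Suc n"
  obtains m r c where "(m, r) \<in> removable_rows l la" "la m r = Suc c" "T (m, r, Suc c) = Suc n"
proof -
  have "Suc n \<in> T ` D" using bij_T n by (auto simp: bij_betw_def)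
  then obtain A where "A \<in> D" "T A = Suc n" by auto
  then obtain m r c' where A: "(m, r, c') \<in> D" "T (m, r, c') = Suc n" by (cases A) auto
  then obtain c where c: "c' = Suc c" by (cases c') (auto simp: diagram_def)
  have m: "1 \<le> m" "m \<le> l" "1 \<le> r" "Suc c \<le> la m r" using A c by (auto simp: diagram_def)
  have "(m, r, Suc (Suc c)) \<notin> D"
    using T_row[of m r "Suc c" "Suc (Suc c)"] T_range[of "(m, r, Suc (Suc c))"] A n c by auto
  moreover have "(m, Suc r, Suc c) \<notin> D"
    using T_column[of m r "Suc c" "Suc r"] T_range[of "(m, Suc r, Suc c)"] A n c by auto
  ultimately have "la m r = Suc c" "la m (Suc r) < la m r"
    using m by (auto simp: diagram_def)
  then show thesis using that[of m r c] m A c by (simp add: removable_rows_def)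
qed

text \<open>Horizontality forbids a pair of nodes and so passes to smaller diagrams. The function
  \<open>T\<close> is kept unchanged, only its domain shrinks.\<close>

lemma horizontal_tableau_dec_row:
  assumes r: "(m, r) \<in> removable_rows l la" and c: "la m r = Suc c"
    and T: "T (m, r, Suc c) = Suc n" and n: "card D = Suc n"
  shows "horizontal_tableau e k l kap (dec_row la m r) T" "card (diagram l (dec_row la m r)) = n"
proof -
  have D: "diagram l (dec_row la m r) = D - {(m, r, Suc c)}"
    using diagram_dec_row[OF r] c by simp
  have A: "(m, r, Suc c) \<in> D" using r c by (auto simp: removable_rows_def diagram_def)
  show card: "card (diagram l (dec_row la m r)) = n" using A D n finite_D by simp
  have "bij_betw T (D - {(m, r, Suc c)}) ({1..Suc n} - {Suc n})"
    using bij_T A T n by (metis bij_betw_DiffI bij_betw_singletonI empty_subsetI insert_subset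
        bij_betw_def imageI)
  moreover have "{1..Suc n} - {Suc n} = {1..n}" by auto
  ultimately have "tableau (diagram l (dec_row la m r)) T"
    using card by (simp add: tableau_def D)
  then have "standard_tableau (diagram l (dec_row la m r)) T"
    using standard_T by (simp add: standard_tableau_def D)
  moreover have "horizontal e kap l k (dec_row la m r)"
    using horizontal_la by (auto simp: horizontal_def D)
  ultimately show "horizontal_tableau e k l kap (dec_row la m r) T"
    using multipartition_dec_row[OF multipartition_la r] by unfold_locales
qed

lemma degree_rec_step:
  assumes r: "(m, r) \<in> removable_rows l la" and c: "la m r = Suc c"
    and T: "T (m, r, Suc c) = Suc n" and n: "card D = Suc n"
  defines "la' \<equiv> dec_row la m r"
  shows "degree_rec (e + 1) kap' l F (card (diagram l mu)) (diagram l mu) =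
    node_degree e kap l D (m, r, Suc c) +
    degree_rec (e + 1) kap' l (subdiv_tableau e kap k (diagram l la') T)
      (card (diagram l (subdiv_shape e kap l k la'))) (diagram l (subdiv_shape e kap l k la'))"
proof -
  interpret R: horizontal_tableau e k l kap la' T
    unfolding la'_def by (rule horizontal_tableau_dec_row[OF r c T n])
  have card_R: "card R.D = n" unfolding la'_def by (rule horizontal_tableau_dec_row[OF r c T n])
  have m: "1 \<le> m" "m \<le> l" "1 \<le> r" using r by (auto simp: removable_rows_def)
  have A: "(m, r, Suc c) \<in> D" using m c by (simp add: diagram_def)
  have RD: "R.D = D - {(m, r, Suc c)}"
    unfolding la'_def using diagram_dec_row[OF r] c by simp
  have la': "la' m' r' = (if m' = m \<and> r' = r then c else la m' r')" for m' r'
    using c by (simp add: la'_def dec_row_def)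
  have inv: "inv_into R.D T j = inv_into D T j" if "1 \<le> j" "j \<le> n" for j
  proof -
    have "j \<in> T ` R.D" using that R.bij_T card_R by (simp add: bij_betw_def)
    then obtain B where "B \<in> R.D" "T B = j" by auto
    then show ?thesis using R.inv_into_T inv_into_T RD by (metis DiffD1)
  qed
  \<comment> \<open>\<open>phi t\<close> sees only entries below \<open>t\<close>; for
    \<open>t \<le> n\<close> these occupy the same nodes in both diagrams.\<close>
  have phi: "R.phi t = phi t" if "t \<le> n" for t
  proof -
    have "{j. 1 \<le> j \<and> j < t \<and> res e kap (inv_into R.D T j) = k} =
      {j. 1 \<le> j \<and> j < t \<and> res e kap (inv_into D T j) = k}"
      using inv that by auto
    then show ?thesis by (simp add: subdiv_entry_def)
  qed
  have F_eq: "R.F B = F B" if "B \<in> diagram l R.mu" for B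
  proof -
    obtain m' r' C where B: "B = (m', r', C)" by (cases B)
    show ?thesis
      using that unfolding B
    proof (cases rule: R.mu_cases)
      case (plus c')
      then have "(m', r', Suc c') \<in> D" using RD by simp
      then show "R.F (m', r', C) = F (m', r', C)"
        using plus R.F_plus[OF plus(1)] F_plus phi R.T_range[OF plus(1)] card_R by simp
    next
      case (sharp c')
      then have "(m', r', Suc c') \<in> D" using RD by simp
      then show "R.F (m', r', C) = F (m', r', C)"
        using sharp R.F_sharp[OF sharp(1,2)] F_sharp phi R.T_range[OF sharp(1)] card_R by simp
    qed
  qed
  have inv_F: "inv_into E F (F B) = B" if "E \<subseteq> diagram l mu" "B \<in> E" for E B
    using bij_F that by (meson bij_betw_def inj_on_subset inv_into_f_f)
  have plus: "(m, r, Suc (len m r c)) \<in> diagram l mu" by (rule plus_in_mu[OF A])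
  have F_plus_A: "F (m, r, Suc (len m r c)) = phi (Suc n)" using F_plus[OF A] T by simp
  have k_entry: "k_entry (Suc n) \<longleftrightarrow> rs m r (Suc c) = k" using k_entry_T[OF A] T by simp
  have fin: "finite (diagram l mu)" by (rule finite_diagram[OF multipartition_mu])
  have rs'_plus: "rs' m r (Suc (len m r c)) = skip (rs m r (Suc c))"
    using rs'_len[OF rs'_first_nonempty[OF m], of c] c by simp
  have diagram_R: "(m', r', C) \<in> diagram l R.mu \<longleftrightarrow>
    (m', r', C) \<in> diagram l mu \<and> \<not> (m' = m \<and> r' = r \<and> len m r c < C)" for m' r' C
    using mu_eq_len[of m' r'] R.mu_eq_len[of m' r'] c len_mono[of c "Suc c" m r]
    by (cases "m' = m \<and> r' = r") (auto simp: diagram_def la')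
  show ?thesis
  \<comment> \<open>For a \<open>k\<close>-node the two largest entries
    \<open>phi (Suc n) + 1\<close> and \<open>phi (Suc n)\<close> are peeled off, unfolding the
    recursion twice; otherwise \<open>phi (Suc n)\<close> is the largest and one unfolding
    suffices.\<close>
  proof (cases "rs m r (Suc c) = k")
    case True
    have mu: "mu m r = Suc (Suc (len m r c))" using mu_eq_len[OF m] c True by simp
    have r_mu: "(m, r) \<in> removable_rows l mu" using r by (simp add: removable_rows_mu)
    define E where "E = diagram l (dec_row mu m r)"
    have E: "E = diagram l mu - {(m, r, Suc (Suc (len m r c)))}"
      using diagram_dec_row[OF r_mu] mu by (simp add: E_def)
    have sharp: "(m, r, Suc (Suc (len m r c))) \<in> diagram l mu" by (rule sharp_in_mu[OF A True])
    have plus_E: "(m, r, Suc (len m r c)) \<in> E" using plus E by simp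
    have E_R: "E - {(m, r, Suc (len m r c))} = diagram l R.mu"
    proof (rule set_eqI)
      fix B :: node
      obtain m' r' C where B: "B = (m', r', C)" by (cases B)
      have "C \<le> Suc (Suc (len m r c))" if "(m, r, C) \<in> diagram l mu"
        using that mu by (simp add: diagram_def)
      then show "B \<in> E - {(m, r, Suc (len m r c))} \<longleftrightarrow> B \<in> diagram l R.mu"
        unfolding B diagram_R E by auto
    qed
    have card: "card (diagram l mu) = Suc (phi (Suc n))"
      using card_mu n phi_Suc[of "Suc n"] k_entry True by simp
    have card_E: "card E = phi (Suc n)" using E sharp fin card by simp
    then have "card E = Suc (card (diagram l R.mu))"
      using E_R plus_E fin E by (metis card_Suc_Diff1 finite_Diff)
    then have N: "phi (Suc n) = Suc (card (diagram l R.mu))" using card_E by simp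
    have "inv_into (diagram l mu) F (Suc (phi (Suc n))) = (m, r, Suc (Suc (len m r c)))"
      using inv_F[OF subset_refl sharp] F_sharp[OF A True] T by simp
    moreover have "inv_into E F (phi (Suc n)) = (m, r, Suc (len m r c))"
      using inv_F[OF _ plus_E] E F_plus_A by auto
    ultimately have "degree_rec (e + 1) kap' l F (card (diagram l mu)) (diagram l mu) =
      node_degree (e + 1) kap' l (diagram l mu) (m, r, Suc (Suc (len m r c))) +
      (node_degree (e + 1) kap' l E (m, r, Suc (len m r c)) +
       degree_rec (e + 1) kap' l F (card (diagram l R.mu)) (diagram l R.mu))"
      using card N by (simp add: Let_def flip: E E_R)
    also have "\<dots> = node_degree e kap l D (m, r, Suc c) +
       degree_rec (e + 1) kap' l F (card (diagram l R.mu)) (diagram l R.mu)"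
      using node_degree_k[OF r, of "Suc c" "Suc (len m r c)" "Suc (Suc (len m r c))"]
        True c rs'_plus rs'_end[OF m] mu skip_eq_k[of k] by (simp add: E_def)
    also have "degree_rec (e + 1) kap' l F (card (diagram l R.mu)) (diagram l R.mu) =
      degree_rec (e + 1) kap' l R.F (card (diagram l R.mu)) (diagram l R.mu)"
      by (rule degree_rec_cong) (simp add: F_eq)
    finally show ?thesis .
  next
    case False
    have mu: "mu m r = Suc (len m r c)" using mu_eq_len[OF m] c False by simp
    have E_R: "diagram l mu - {(m, r, Suc (len m r c))} = diagram l R.mu"
    proof (rule set_eqI)
      fix B :: node
      obtain m' r' C where B: "B = (m', r', C)" by (cases B)
      have "C \<le> Suc (len m r c)" if "(m, r, C) \<in> diagram l mu"
        using that mu by (simp add: diagram_def)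
      then show "B \<in> diagram l mu - {(m, r, Suc (len m r c))} \<longleftrightarrow> B \<in> diagram l R.mu"
        unfolding B diagram_R by auto
    qed
    have card: "card (diagram l mu) = phi (Suc n)"
      using card_mu n phi_Suc[of "Suc n"] k_entry False by simp
    have card': "card (diagram l mu) = Suc (card (diagram l R.mu))"
      using E_R plus fin by (metis card_Suc_Diff1)
    have "inv_into (diagram l mu) F (card (diagram l mu)) = (m, r, Suc (len m r c))"
      using inv_F[OF subset_refl plus] F_plus_A card by simp
    then have "degree_rec (e + 1) kap' l F (card (diagram l mu)) (diagram l mu) =
      node_degree (e + 1) kap' l (diagram l mu) (m, r, Suc (len m r c)) +
      degree_rec (e + 1) kap' l F (card (diagram l R.mu)) (diagram l R.mu)"
      unfolding card' by (simp add: Let_def E_R)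
    also have "node_degree (e + 1) kap' l (diagram l mu) (m, r, Suc (len m r c)) =
      node_degree e kap l D (m, r, Suc c)"
      using node_degree_non_k[OF False rs'_plus] by simp
    also have "degree_rec (e + 1) kap' l F (card (diagram l R.mu)) (diagram l R.mu) =
      degree_rec (e + 1) kap' l R.F (card (diagram l R.mu)) (diagram l R.mu)"
      by (rule degree_rec_cong) (simp add: F_eq)
    finally show ?thesis .
  qed
qed

end

text \<open>Induction on the number of nodes with \<open>T\<close> fixed: as a total function it
  serves all the smaller shapes, while its subdivision is recomputed for each.\<close>

lemma degree_subdivision:
  assumes "horizontal_tableau e k l kap la T"
  shows "degree e kap l (diagram l la) T =
    degree (e + 1) (subdiv_charge k kap) l (diagram l (subdiv_shape e kap l k la))
      (subdiv_tableau e kap k (diagram l la) T)"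
  using assms
proof (induction "card (diagram l la)" arbitrary: la)
  case 0
  then interpret horizontal_tableau e k l kap la T by simp
  have "card (diagram l mu) = 0" using card_mu 0(1) by (simp add: subdiv_entry_def)
  then show ?case using 0(1) by (simp add: degree_def)
next
  case (Suc n)
  interpret horizontal_tableau e k l kap la T by (rule Suc.prems)
  have n: "card D = Suc n" using Suc.hyps(2) by simp
  obtain m r c where mrc: "(m, r) \<in> removable_rows l la" "la m r = Suc c" "T (m, r, Suc c) = Suc n"
    by (rule largest_entry[OF n])
  have D: "D - {(m, r, Suc c)} = diagram l (dec_row la m r)"
    using diagram_dec_row[OF mrc(1)] mrc(2) by simp
  have A: "(m, r, Suc c) \<in> D" using mrc by (auto simp: removable_rows_def diagram_def)
  have inv: "inv_into D T (Suc n) = (m, r, Suc c)" using inv_into_T[OF A] mrc(3) by simp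
  note IH = Suc.hyps(1)[OF horizontal_tableau_dec_row(2)[OF mrc n, symmetric]
      horizontal_tableau_dec_row(1)[OF mrc n]]
  have "degree e kap l D T = node_degree e kap l D (m, r, Suc c) +
      degree e kap l (diagram l (dec_row la m r)) T"
    using n inv D horizontal_tableau_dec_row(2)[OF mrc n] by (simp add: degree_def)
  then show ?case
    using IH degree_rec_step[OF mrc n] by (simp add: degree_def)
qed

theorem theorem5p53:
  fixes e k :: int and l :: nat and kap :: charge and la :: shape and T :: "node \<Rightarrow> nat"
  assumes "e \<ge> 3"
    and "k \<in> {0..<e}"
    and "l \<ge> 1"
    and "\<forall>m\<in>{1..l}. kap m \<in> {0..<e}"
    and "multipartition l la"
    and "horizontal e kap l k la"
    and "standard_tableau (diagram l la) T"
  shows "multipartition l (subdiv_shape e kap l k la) \<and>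
         standard_tableau (diagram l (subdiv_shape e kap l k la))
           (subdiv_tableau e kap k (diagram l la) T) \<and>
         degree e kap l (diagram l la) T =
           degree (e + 1) (subdiv_charge k kap) l (diagram l (subdiv_shape e kap l k la))
             (subdiv_tableau e kap k (diagram l la) T)"
proof -
  interpret horizontal_tableau e k l kap la T
    using assms by unfold_locales auto
  show ?thesis
    using multipartition_mu standard_F degree_subdivision[OF horizontal_tableau_axioms] by blast
qed

end
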